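(* Let $\Gamma$ be a Kleinian group and $\gamma$ a non-trivial element of $\Gamma$. Then the canonical map $Q(\Gamma,\gamma)\to \mathrm{Conj}(\mathrm{PSL}(2,\mathbb{C}))$ is an injective quandle homomorphism. Moreover, if either (1) $\Gamma$ is isomorphic to the fundamental group of a complete hyperbolic $3$-orbifold of finite volume and $\gamma$ is parabolic, or (2) $\gamma$ is not parabolic and the cardinality of $C_\Gamma(\gamma)$ is infinite, then the image of the canonical map is discrete in $\mathrm{Conj}(\mathrm{PSL}(2,\mathbb{C}))$ and is contained in a connected component of $\mathrm{Conj}(\mathrm{PSL}(2,\mathbb{C}))$.
   Context: A quandle is a non-empty set $X$ with a binary operation $\lhd$ such that $x\lhd x=x$; for every $y$ the map $s_y:X\to X$, $s_y(x)=x\lhd y$, is a bijection; and $(x\lhd y)\lhd z=(x\lhd z)\lhd(y\lhd z)$. A quandle homomorphism is a map $f$ with $f(x\lhd x')=f(x)\lhd f(x')$. The inner automorphism group of $X$ is the group of bijections of $X$ generated by all $s_y$; a connected component of $X$ is an orbit of this group on $X$. For a group $G$, $\mathrm{Conj}(G)$ is the quandle with underlying set $G$ and $x\lhd y=y^{-1}xy$; conjugation-closed subsets are subquandles. A quandle triplet $(G,H,\sigma)$ consists of a group $G$, an automorphism $\sigma$ of $G$ and a subgroup $H$ of $\{g\in G\mid\sigma(g)=g\}$; it defines the quandle $Q(G,H,\sigma)$ with underlying set $H\backslash G$ and $Hx\lhd Hy:=H\sigma(xy^{-1})y$. A Kleinian group is a discrete subgroup of $\mathrm{PSL}(2,\mathbb{C})=\mathrm{SL}(2,\mathbb{C})/\{\pm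 I_2\}$, the orientation-preserving isometry group of hyperbolic $3$-space, with its usual topology. For $\gamma\in\Gamma$ let $\sigma_\gamma(g)=\gamma^{-1}g\gamma$, let $C_\Gamma(\gamma)=\{g\in\Gamma\mid\sigma_\gamma(g)=g\}$ be the centralizer, and put $Q(\Gamma,\gamma):=Q(\Gamma,C_\Gamma(\gamma),\sigma_\gamma)$. A non-identity element of $\mathrm{PSL}(2,\mathbb{C})$ is parabolic if a matrix representing it has trace $\pm2$. Let $\mathcal{T}=\mathbb{C}/(z\sim -z)$ and $[t]=\{\pm t\}$. For $\tau\in\mathcal{T}$, let $X_\tau$ be the set of non-identity elements of $\mathrm{PSL}(2,\mathbb{C})$ represented by a matrix with trace in $\tau$; it is a single conjugacy class. Regard elements of $\mathrm{PSL}(2,\mathbb C)$ as linear fractional transformations. The base point $f_\tau\in X_\tau$ is $f_{[2]}(z)=z+1$, and for $\tau=[t]\ne[2]$, $f_\tau(z)=\lambda_t^2z$, where $\lambda_t=e^{i\theta}$ if $t=2\cos\theta\in(-2,2)$, $\theta\in(-\pi,\pi)$, and $\lambda_t=\lambda$ if $t=\lambda+\lambda^{-1}\in\mathbb{C}\setminus[-2,2]$ with $|\lambda|>1$ (any fixed choice of representative $t$ and of $\theta$). Let $H_\tau$ be the centralizer of $f_\tau$ in $\mathrm{PSL}(2,\mathbb{C})$ and $\sigma_\tau(g)=f_\tau^{-1}gf_\tau$. The canonical map is defined as follows. Let $\tau$ be such that $\gamma\in X_\tau$ and choose $f\in\mathrm{PSL}(2,\mathbb{C})$ with $f\gamma f^{-1}=f_\tau$.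 Let $\psi:Q(\Gamma,\gamma)\to Q(\mathrm{PSL}(2,\mathbb{C}),H_\tau,\sigma_\tau)$, $\psi(C_\Gamma(\gamma)g)=H_\tau fgf^{-1}$; let $F:Q(\mathrm{PSL}(2,\mathbb{C}),H_\tau,\sigma_\tau)\to\mathrm{Conj}(X_\tau)$, $F(H_\tau g)=g^{-1}f_\tau g$; and let $i:\mathrm{Conj}(X_\tau)\to\mathrm{Conj}(\mathrm{PSL}(2,\mathbb{C}))$ be the inclusion. The canonical map is $i\circ F\circ\psi$. A subset of $\mathrm{Conj}(\mathrm{PSL}(2,\mathbb{C}))$ is discrete if its relative topology from $\mathrm{PSL}(2,\mathbb{C})$ is discrete. *)

theory Defs
  imports "HOL-Analysis.Analysis" "HOL-Algebra.Algebra"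
begin

section \<open>Quandles\<close>

record 'a magma = "'a partial_object" +
  qop :: "'a \<Rightarrow> 'a \<Rightarrow> 'a" (infixl "\<triangleleft>\<index>" 70)

definition quandle :: "('a, 'm) magma_scheme \<Rightarrow> bool" where
  "quandle Q \<longleftrightarrow>
     carrier Q \<noteq> {} \<and>
     (\<forall>x\<in>carrier Q. \<forall>y\<in>carrier Q. x \<triangleleft>\<^bsub>Q\<^esub> y \<in> carrier Q) \<and>
     (\<forall>x\<in>carrier Q. x \<triangleleft>\<^bsub>Q\<^esub> x = x) \<and>
     (\<forall>y\<in>carrier Q. bij_betw (\<lambda>x. x \<triangleleft>\<^bsub>Q\<^esub> y) (carrier Q) (carrier Q)) \<and>
     (\<forall>x\<in>carrier Q. \<forall>y\<in>carrier Q. \<forall>z\<in>carrier Q.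
        (x \<triangleleft>\<^bsub>Q\<^esub> y) \<triangleleft>\<^bsub>Q\<^esub> z = (x \<triangleleft>\<^bsub>Q\<^esub> z) \<triangleleft>\<^bsub>Q\<^esub> (y \<triangleleft>\<^bsub>Q\<^esub> z))"

definition quandle_hom ::
  "('a, 'm) magma_scheme \<Rightarrow> ('b, 'n) magma_scheme \<Rightarrow> ('a \<Rightarrow> 'b) \<Rightarrow> bool" where
  "quandle_hom Q R f \<longleftrightarrow>
     quandle Q \<and> quandle R \<and> f \<in> carrier Q \<rightarrow> carrier R \<and>
     (\<forall>x\<in>carrier Q. \<forall>y\<in>carrier Q. f (x \<triangleleft>\<^bsub>Q\<^esub> y) = f x \<triangleleft>\<^bsub>R\<^esub> f y)"

definition right_translation :: "('a, 'm) magma_scheme \<Rightarrow> 'a \<Rightarrow> 'a \<Rightarrow> 'a" where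
  "right_translation Q y = (\<lambda>x\<in>carrier Q. x \<triangleleft>\<^bsub>Q\<^esub> y)"

definition Inn :: "('a, 'm) magma_scheme \<Rightarrow> ('a \<Rightarrow> 'a) monoid" where
  "Inn Q = (BijGroup (carrier Q))
     \<lparr>carrier := generate (BijGroup (carrier Q)) (right_translation Q ` carrier Q)\<rparr>"

definition quandle_components :: "('a, 'm) magma_scheme \<Rightarrow> 'a set set" where
  "quandle_components Q = orbits (Inn Q) (carrier Q) (\<lambda>\<phi>. \<phi>)"

definition Conj :: "('a, 'm) monoid_scheme \<Rightarrow> 'a magma" where
  "Conj G = \<lparr>carrier = carrier G, qop = (\<lambda>x y. inv\<^bsub>G\<^esub> y \<otimes>\<^bsub>G\<^esub> x \<otimes>\<^bsub>G\<^esub> y)\<rparr>"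

text \<open>
  The quandle of a triplet \<open>(G, H, \<sigma>)\<close>, on the right cosets \<open>H x\<close>.  As for the maps induced on a
  quotient group in \<^theory>\<open>HOL-Algebra.Coset\<close>, the operation is defined through representatives:
  since the value does not depend on them, the image under \<^const>\<open>the_elem\<close> is a singleton.
\<close>

definition triplet_quandle ::
  "('a, 'm) monoid_scheme \<Rightarrow> 'a set \<Rightarrow> ('a \<Rightarrow> 'a) \<Rightarrow> 'a set magma" where
  "triplet_quandle G H \<sigma> =
     \<lparr>carrier = rcosets\<^bsub>G\<^esub> H,
      qop = (\<lambda>A B. the_elem
        ((\<lambda>(x, y). H #>\<^bsub>G\<^esub> (\<sigma> (x \<otimes>\<^bsub>G\<^esub> inv\<^bsub>G\<^esub> y) \<otimes>\<^bsub>G\<^esub> y)) ` (A \<times> B)))\<rparr>"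

definition conj_by :: "('a, 'm) monoid_scheme \<Rightarrow> 'a \<Rightarrow> 'a \<Rightarrow> 'a" where
  "conj_by G c g = inv\<^bsub>G\<^esub> c \<otimes>\<^bsub>G\<^esub> g \<otimes>\<^bsub>G\<^esub> c"

definition centralizer :: "('a, 'm) monoid_scheme \<Rightarrow> 'a \<Rightarrow> 'a set" where
  "centralizer G c = {g \<in> carrier G. conj_by G c g = g}"

definition centralizer_quandle :: "('a, 'm) monoid_scheme \<Rightarrow> 'a \<Rightarrow> 'a set magma" where
  "centralizer_quandle G c = triplet_quandle G (centralizer G c) (conj_by G c)"


section \<open>The topological group PSL(2,C) and Kleinian groups\<close>

type_synonym mat2 = "complex^2^2"

definition mat2 :: "complex \<Rightarrow> complex \<Rightarrow> complex \<Rightarrow> complex \<Rightarrow> mat2" where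
  "mat2 a b c d = vector [vector [a, b], vector [c, d]]"

definition SL2C :: "mat2 monoid" where
  "SL2C = \<lparr>carrier = {A. det A = 1}, mult = (**), one = mat 1\<rparr>"

definition PSL2C :: "mat2 set monoid" where
  "PSL2C = SL2C Mod {mat 1, - mat 1}"

definition proj_class :: "mat2 \<Rightarrow> mat2 set" where
  "proj_class A = {A, - A}"

text \<open>The quotient topology; an element of PSL(2,C) is a set of matrices, so the preimage in
  SL(2,C) of a set \<open>U\<close> of such elements is \<open>\<Union>U\<close>.\<close>

definition PSL2C_topology :: "mat2 set topology" where
  "PSL2C_topology =
     topology (\<lambda>U. U \<subseteq> carrier PSL2C \<and> openin (top_of_set (carrier SL2C)) (\<Union>U))"

definition discrete_in :: "'a topology \<Rightarrow> 'a set \<Rightarrow> bool" where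
  "discrete_in T S \<longleftrightarrow> S \<subseteq> topspace T \<and> subtopology T S = discrete_topology S"

definition Kleinian_group :: "mat2 set set \<Rightarrow> bool" where
  "Kleinian_group \<Gamma> \<longleftrightarrow> subgroup \<Gamma> PSL2C \<and> discrete_in PSL2C_topology \<Gamma>"

definition Kleinian_quandle :: "mat2 set set \<Rightarrow> mat2 set \<Rightarrow> mat2 set set magma" where
  "Kleinian_quandle \<Gamma> \<gamma> = centralizer_quandle (PSL2C\<lparr>carrier := \<Gamma>\<rparr>) \<gamma>"

definition parabolic :: "mat2 set \<Rightarrow> bool" where
  "parabolic p \<longleftrightarrow> p \<in> carrier PSL2C \<and> p \<noteq> \<one>\<^bsub>PSL2C\<^esub> \<and> (\<exists>A\<in>p. trace A = 2 \<or> trace A = - 2)"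

lemma group_SL2C: "group SL2C"
proof (rule groupI)
  fix A assume "A \<in> carrier SL2C"
  hence d: "det A = 1" by (simp add: SL2C_def)
  then obtain B where B: "A ** B = mat 1" "B ** A = mat 1"
    by (metis invertible_def invertible_det_nz zero_neq_one)
  have "det B = 1" using B(1) d by (metis det_I det_mul mult_1)
  thus "\<exists>B\<in>carrier SL2C. B \<otimes>\<^bsub>SL2C\<^esub> A = \<one>\<^bsub>SL2C\<^esub>" using B by (auto simp: SL2C_def)
qed (auto simp: SL2C_def det_mul matrix_mul_assoc)

lemma det_uminus_mat2: "det (- A) = det (A :: mat2)"
  by (simp add: det_2)

lemma matrix_mult_uminus: "(- A) ** B = - (A ** B)" "A ** (- B) = - (A ** B)" for A B :: mat2
  by (simp_all add: matrix_matrix_mult_def vec_eq_iff sum_negf)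

lemma normal_pm_one: "normal {mat 1, - mat 1} SL2C"
proof -
  interpret group SL2C by (rule group_SL2C)
  have sub: "subgroup {mat 1, - mat 1} SL2C"
  proof (rule subgroupI)
    show "{mat 1, - mat 1} \<subseteq> carrier SL2C" by (auto simp: SL2C_def det_uminus_mat2)
  next
    fix a assume a: "a \<in> {mat 1, - mat 1 :: mat2}"
    hence "a \<otimes>\<^bsub>SL2C\<^esub> a = \<one>\<^bsub>SL2C\<^esub>" "a \<in> carrier SL2C"
      by (auto simp: SL2C_def matrix_mult_uminus det_uminus_mat2)
    hence "inv\<^bsub>SL2C\<^esub> a = a" by (simp add: inv_equality)
    thus "inv\<^bsub>SL2C\<^esub> a \<in> {mat 1, - mat 1}" using a by simp
  qed (auto simp: SL2C_def matrix_mult_uminus)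
  show ?thesis
  proof (rule normalI[OF sub], rule ballI)
    fix A assume "A \<in> carrier SL2C"
    show "{mat 1, - mat 1} #>\<^bsub>SL2C\<^esub> A = A <#\<^bsub>SL2C\<^esub> {mat 1, - mat 1}"
      by (auto simp: r_coset_def l_coset_def SL2C_def matrix_mult_uminus)
  qed
qed

lemma group_PSL2C: "group PSL2C"
  unfolding PSL2C_def using normal.factorgroup_is_group[OF normal_pm_one] .

lemma carrier_PSL2C: "carrier PSL2C = proj_class ` {A. det A = 1}"
  by (auto simp: PSL2C_def FactGroup_def RCOSETS_def r_coset_def SL2C_def matrix_mult_uminus
      proj_class_def image_iff)

lemma openin_PSL2C_topology:
  "openin PSL2C_topology U \<longleftrightarrow>
     U \<subseteq> carrier PSL2C \<and> openin (top_of_set (carrier SL2C)) (\<Union>U)"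
proof -
  have Int: "\<Union>(S \<inter> T) = \<Union>S \<inter> \<Union>T" if "S \<subseteq> carrier PSL2C" "T \<subseteq> carrier PSL2C" for S T
  proof -
    have "p = q" if "p \<in> carrier PSL2C" "q \<in> carrier PSL2C" "A \<in> p" "A \<in> q" for p q A
      using that by (auto simp: carrier_PSL2C proj_class_def)
    thus ?thesis using that by blast
  qed
  have Un: "openin (top_of_set (carrier SL2C)) (\<Union>(\<Union>K))"
    if "\<forall>U\<in>K. openin (top_of_set (carrier SL2C)) (\<Union>U)" for K :: "mat2 set set set"
  proof -
    have "\<Union>(\<Union>K) = \<Union>(Union ` K)" by blast
    thus ?thesis using that by (metis (no_types, lifting) imageE openin_Union)
  qed
  have "istopology (\<lambda>U. U \<subseteq> carrier PSL2C \<and> openin (top_of_set (carrier SL2C)) (\<Union>U))"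
    unfolding istopology_def using Un by (auto simp: Int)
  thus ?thesis unfolding PSL2C_topology_def by simp
qed


section \<open>Hyperbolic 3-space and orbifold fundamental groups\<close>

text \<open>The upper half-space model.\<close>

definition H3 :: "(complex \<times> real) set" where
  "H3 = {(z, t). t > 0}"

definition hyp_dist :: "complex \<times> real \<Rightarrow> complex \<times> real \<Rightarrow> real" where
  "hyp_dist p q = arcosh (1 + (dist p q)\<^sup>2 / (2 * snd p * snd q))"

definition hyp_volume :: "(complex \<times> real) measure" where
  "hyp_volume = density lborel (\<lambda>p. ennreal (indicator H3 p / snd p ^ 3))"

definition Isom_H3 :: "(complex \<times> real \<Rightarrow> complex \<times> real) monoid" where
  "Isom_H3 = (BijGroup H3)
     \<lparr>carrier := {g \<in> Bij H3. \<forall>p\<in>H3. \<forall>q\<in>H3. hyp_dist (g p) (g q) = hyp_dist p q}\<rparr>"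

definition properly_discontinuous :: "(complex \<times> real \<Rightarrow> complex \<times> real) set \<Rightarrow> bool" where
  "properly_discontinuous L \<longleftrightarrow>
     (\<forall>K. compact K \<and> K \<subseteq> H3 \<longrightarrow> finite {g \<in> L. g ` K \<inter> K \<noteq> {}})"

definition fundamental_domain ::
  "(complex \<times> real \<Rightarrow> complex \<times> real) set \<Rightarrow> (complex \<times> real) set \<Rightarrow> bool" where
  "fundamental_domain L D \<longleftrightarrow>
     D \<in> sets borel \<and> D \<subseteq> H3 \<and> (\<Union>g\<in>L. g ` D) = H3 \<and>
     (\<forall>g\<in>L. g \<noteq> \<one>\<^bsub>Isom_H3\<^esub> \<longrightarrow> emeasure hyp_volume (g ` D \<inter> D) = 0)"

text \<open>
  A complete hyperbolic 3-orbifold is a quotient of \<^const>\<open>H3\<close> by a group \<open>L\<close> of isometries acting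
  properly discontinuously; its (orbifold) fundamental group is \<open>L\<close>, and its volume is the volume
  of any fundamental domain of \<open>L\<close>.  The orbifold is not required to be orientable.
\<close>

definition finite_volume_orbifold_group :: "(complex \<times> real \<Rightarrow> complex \<times> real) set \<Rightarrow> bool" where
  "finite_volume_orbifold_group L \<longleftrightarrow>
     subgroup L Isom_H3 \<and> properly_discontinuous L \<and>
     (\<exists>D. fundamental_domain L D \<and> emeasure hyp_volume D < \<infinity>)"

definition iso_to_finite_volume_orbifold_group :: "mat2 set set \<Rightarrow> bool" where
  "iso_to_finite_volume_orbifold_group \<Gamma> \<longleftrightarrow>
     (\<exists>L. finite_volume_orbifold_group L \<and>
          PSL2C\<lparr>carrier := \<Gamma>\<rparr> \<cong> Isom_H3\<lparr>carrier := L\<rparr>)"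


section \<open>Trace classes, base points and the canonical map\<close>

definition trace_class :: "complex \<Rightarrow> complex set" where
  "trace_class t = {t, - t}"

definition X_class :: "complex set \<Rightarrow> mat2 set set" where
  "X_class \<tau> = {p \<in> carrier PSL2C. p \<noteq> \<one>\<^bsub>PSL2C\<^esub> \<and> (\<exists>A\<in>p. trace A \<in> \<tau>)}"

text \<open>\<open>is_lambda t l\<close>: \<open>l\<close> is an admissible value of \<open>\<lambda>\<^sub>t\<close>; for \<open>t\<close> in \<open>(-2,2)\<close> there are two,
  one for each choice of \<open>\<theta>\<close>.\<close>

definition is_lambda :: "complex \<Rightarrow> complex \<Rightarrow> bool" where
  "is_lambda t l \<longleftrightarrow>
     (\<exists>\<theta>::real. - pi < \<theta> \<and> \<theta> < pi \<and> 2 * cos \<theta> \<in> {-2<..<2} \<and>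
        t = complex_of_real (2 * cos \<theta>) \<and> l = exp (\<i> * complex_of_real \<theta>)) \<or>
     (t \<notin> complex_of_real ` {-2..2} \<and> t = l + inverse l \<and> cmod l > 1)"

text \<open>
  \<open>is_base_point \<tau> p\<close>: \<open>p\<close> is the base point of \<^term>\<open>X_class \<tau>\<close> for some choice of the
  representative \<open>t\<close> and of \<open>\<theta>\<close>.  The matrices represent the linear fractional transformations
  \<open>z + 1\<close> and \<open>\<lambda>\<^sub>t\<^sup>2 z\<close>, see the lemmas on \<open>lin_frac\<close> below.
\<close>

definition is_base_point :: "complex set \<Rightarrow> mat2 set \<Rightarrow> bool" where
  "is_base_point \<tau> p \<longleftrightarrow>
     (if \<tau> = trace_class 2 then p = proj_class (mat2 1 1 0 1)
      else \<exists>t l. \<tau> = trace_class t \<and> is_lambda t l \<and> p = proj_class (mat2 l 0 0 (inverse l)))"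

definition lin_frac :: "mat2 \<Rightarrow> complex \<Rightarrow> complex" where
  "lin_frac A z = (A$1$1 * z + A$1$2) / (A$2$1 * z + A$2$2)"

lemma lin_frac_base_points:
  "lin_frac (mat2 1 1 0 1) z = z + 1"
  "lin_frac (mat2 l 0 0 (inverse l)) z = l\<^sup>2 * z"
  by (simp_all add: lin_frac_def mat2_def power2_eq_square field_simps)

lemma lin_frac_uminus: "lin_frac (- A) z = lin_frac A z"
proof -
  have "lin_frac (- A) z = (- (A$1$1 * z + A$1$2)) / (- (A$2$1 * z + A$2$2))"
    by (simp add: lin_frac_def)
  thus ?thesis by (simp only: lin_frac_def minus_divide_left[symmetric] minus_divide_right[symmetric] minus_minus)
qed

text \<open>The maps \<open>\<psi>\<close> and \<open>F\<close> of cosets, again defined through representatives.  Here \<open>b\<close> is the base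
  point \<open>f\<^sub>\<tau>\<close>, and \<open>\<psi>\<close> depends on \<open>\<Gamma>\<close> and \<open>\<gamma>\<close> only through its domain.\<close>

definition psi_map :: "mat2 set \<Rightarrow> mat2 set \<Rightarrow> mat2 set set \<Rightarrow> mat2 set set" where
  "psi_map b f c = the_elem
     ((\<lambda>g. centralizer PSL2C b #>\<^bsub>PSL2C\<^esub> (f \<otimes>\<^bsub>PSL2C\<^esub> g \<otimes>\<^bsub>PSL2C\<^esub> inv\<^bsub>PSL2C\<^esub> f)) ` c)"

definition F_map :: "mat2 set \<Rightarrow> mat2 set set \<Rightarrow> mat2 set" where
  "F_map b c = the_elem ((\<lambda>g. inv\<^bsub>PSL2C\<^esub> g \<otimes>\<^bsub>PSL2C\<^esub> b \<otimes>\<^bsub>PSL2C\<^esub> g) ` c)"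

text \<open>The inclusion of \<open>Conj(X\<^sub>\<tau>)\<close> into \<open>Conj(PSL(2,C))\<close> is the identity on elements.\<close>

definition canonical_map :: "mat2 set \<Rightarrow> mat2 set \<Rightarrow> mat2 set set \<Rightarrow> mat2 set" where
  "canonical_map b f = F_map b \<circ> psi_map b f"

end

theory Submission
  imports Defs
begin

text \<open>
  The canonical map sends the coset of \<open>g\<close> to \<open>f g\<^sup>-\<^sup>1 \<gamma> g f\<^sup>-\<^sup>1\<close>.  Two elements of \<open>\<Gamma>\<close> conjugate \<open>\<gamma>\<close> to
  the same element iff they lie in the same coset of the centralizer, so the map is a bijection onto
  \<open>f (\<gamma>\<^sup>\<Gamma>) f\<^sup>-\<^sup>1\<close>, where \<open>\<gamma>\<^sup>\<Gamma>\<close> is the conjugacy class of \<open>\<gamma>\<close> in \<open>\<Gamma>\<close>.  This set lies in a single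
  conjugacy class of PSL(2,C), and it is discrete because conjugation by \<open>f\<close> is a homeomorphism and
  discreteness of the relative topology passes from \<open>\<Gamma>\<close> to its subsets.
\<close>

text \<open>Evaluates the maps defined through coset representatives: once the value is known to be
  independent of the representative, any convenient one may be used.\<close>

lemma the_elem_image_constant:
  assumes "x \<in> A" and "\<And>y. y \<in> A \<Longrightarrow> g y = g x"
  shows "the_elem (g ` A) = g x"
proof -
  have "g ` A = {g x}" using assms by blast
  thus ?thesis by simp
qed

section \<open>Conjugation and centralizer cosets in an abstract group\<close>

context group
begin

lemma inv_mult_cancel_left [simp]:
  "\<lbrakk>x \<in> carrier G; y \<in> carrier G\<rbrakk> \<Longrightarrow> inv x \<otimes> (x \<otimes> y) = y"
  "\<lbrakk>x \<in> carrier G; y \<in> carrier G\<rbrakk> \<Longrightarrow> x \<otimes> (inv x \<otimes> y) = y"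
  by (simp_all flip: m_assoc)

lemma conj_by_closed [simp]:
  "c \<in> carrier G \<Longrightarrow> x \<in> carrier G \<Longrightarrow> conj_by G c x \<in> carrier G"
  by (simp add: conj_by_def)

text \<open>In the form \<open>inv c \<otimes> x \<otimes> c\<close> conjugation is a right action,
  so the factors multiply in the order in which they act.\<close>

lemma conj_by_conj_by:
  "\<lbrakk>c \<in> carrier G; d \<in> carrier G; x \<in> carrier G\<rbrakk> \<Longrightarrow>
    conj_by G d (conj_by G c x) = conj_by G (c \<otimes> d) x"
  by (simp add: conj_by_def m_assoc inv_mult_group)

lemma conj_by_mult:
  "\<lbrakk>c \<in> carrier G; x \<in> carrier G; y \<in> carrier G\<rbrakk> \<Longrightarrow>
    conj_by G c (x \<otimes> y) = conj_by G c x \<otimes> conj_by G c y"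
  by (simp add: conj_by_def m_assoc)

lemma conj_by_one [simp]: "x \<in> carrier G \<Longrightarrow> conj_by G \<one> x = x"
  by (simp add: conj_by_def)

lemma conj_by_inv:
  "\<lbrakk>c \<in> carrier G; x \<in> carrier G\<rbrakk> \<Longrightarrow> conj_by G c (inv x) = inv (conj_by G c x)"
  by (simp add: conj_by_def m_assoc inv_mult_group)

lemma inj_on_conj_by: "c \<in> carrier G \<Longrightarrow> inj_on (conj_by G c) (carrier G)"
  by (rule inj_on_inverseI[where g = "conj_by G (inv c)"]) (simp add: conj_by_conj_by)

lemma conj_by_eq_self_iff:
  "\<lbrakk>c \<in> carrier G; x \<in> carrier G\<rbrakk> \<Longrightarrow> conj_by G c x = x \<longleftrightarrow> c \<otimes> x = x \<otimes> c"
  using inv_solve_left'[of x c "x \<otimes> c"] by (auto simp: conj_by_def m_assoc)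

text \<open>Both conditions mean that \<open>h\<close> and \<open>c\<close> commute. The definition
  describes the fixed points of conjugation by \<open>c\<close>; this form describes the stabilizer
  of \<open>c\<close>, on which the coset arguments rest.\<close>

lemma mem_centralizer_iff:
  "c \<in> carrier G \<Longrightarrow> h \<in> centralizer G c \<longleftrightarrow> h \<in> carrier G \<and> conj_by G h c = c"
  by (auto simp: centralizer_def conj_by_eq_self_iff)

lemma subgroup_centralizer:
  assumes "c \<in> carrier G"
  shows "subgroup (centralizer G c) G"
proof (rule subgroupI)
  show "centralizer G c \<noteq> {}"
    using assms by (auto simp: centralizer_def conj_by_def)
qed (use assms in \<open>auto simp: centralizer_def conj_by_mult conj_by_inv\<close>)

lemma r_coset_centralizer_self:
  "\<lbrakk>c \<in> carrier G; x \<in> carrier G\<rbrakk> \<Longrightarrow> x \<in> centralizer G c #> x"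
  by (rule rcos_self[OF _ subgroup_centralizer])

text \<open>Orbit-stabilizer principle: the right cosets of the stabilizer of \<open>c\<close> are
  the fibres of the orbit map sending \<open>x\<close> to \<open>conj_by G x c\<close>.\<close>

lemma mem_r_coset_centralizer_iff:
  assumes "c \<in> carrier G" "x \<in> carrier G"
  shows "y \<in> centralizer G c #> x \<longleftrightarrow> y \<in> carrier G \<and> conj_by G y c = conj_by G x c"
proof
  assume "y \<in> centralizer G c #> x"
  then obtain h where h: "h \<in> centralizer G c" "y = h \<otimes> x" by (auto simp: r_coset_def)
  thus "y \<in> carrier G \<and> conj_by G y c = conj_by G x c"
    using assms by (simp add: mem_centralizer_iff conj_by_conj_by[symmetric])
next
  assume y: "y \<in> carrier G \<and> conj_by G y c = conj_by G x c"
  \<comment> \<open>Acting by \<open>y\<close> and then undoing \<open>x\<close> brings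
    \<open>c\<close> back to itself.\<close>
  have "conj_by G (y \<otimes> inv x) c = conj_by G (inv x) (conj_by G x c)"
    using y assms by (simp flip: conj_by_conj_by)
  also have "\<dots> = c" using assms by (simp add: conj_by_conj_by)
  finally have "y \<otimes> inv x \<in> centralizer G c" using y assms by (simp add: mem_centralizer_iff)
  moreover have "y = (y \<otimes> inv x) \<otimes> x" using y assms by (simp add: m_assoc)
  ultimately show "y \<in> centralizer G c #> x" unfolding r_coset_def by blast
qed

lemma r_coset_centralizer_eq_iff:
  assumes "c \<in> carrier G" "x \<in> carrier G" "y \<in> carrier G"
  shows "centralizer G c #> x = centralizer G c #> y \<longleftrightarrow> conj_by G x c = conj_by G y c"
  using assms by (auto simp: mem_r_coset_centralizer_iff set_eq_iff)

section \<open>The quandle on the cosets of a centralizer\<close>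

lemma carrier_centralizer_quandle:
  "carrier (centralizer_quandle G c) = (\<lambda>x. centralizer G c #> x) ` carrier G"
  by (auto simp: centralizer_quandle_def triplet_quandle_def RCOSETS_def)

text \<open>The central computation: the orbit map of \<open>c\<close> turns the coset operation
  into conjugation. The right-hand side involves \<open>x\<close> and \<open>y\<close> only through
  their conjugates of \<open>c\<close>, which also makes the operation well defined.\<close>

lemma conj_by_centralizer_quandle_rep:
  assumes "c \<in> carrier G" "x \<in> carrier G" "y \<in> carrier G"
  shows "conj_by G (conj_by G c (x \<otimes> inv y) \<otimes> y) c
    = conj_by G (conj_by G y c) (conj_by G x c)"
  using assms by (simp add: conj_by_def m_assoc inv_mult_group)

text \<open>Other representatives give the same conjugates of \<open>c\<close>, hence by the
  preceding computation the same coset.\<close>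

lemma centralizer_quandle_op:
  assumes c: "c \<in> carrier G" and x: "x \<in> carrier G" and y: "y \<in> carrier G"
  shows "(centralizer G c #> x) \<triangleleft>\<^bsub>centralizer_quandle G c\<^esub> (centralizer G c #> y)
    = centralizer G c #> (conj_by G c (x \<otimes> inv y) \<otimes> y)"
proof -
  let ?C = "centralizer G c"
  let ?g = "\<lambda>(x, y). ?C #> (conj_by G c (x \<otimes> inv y) \<otimes> y)"
  have "the_elem (?g ` ((?C #> x) \<times> (?C #> y))) = ?g (x, y)"
  proof (rule the_elem_image_constant)
    show "(x, y) \<in> (?C #> x) \<times> (?C #> y)" using c x y by (simp add: r_coset_centralizer_self)
  next
    fix p assume "p \<in> (?C #> x) \<times> (?C #> y)"
    thus "?g p = ?g (x, y)" using c x y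
      by (auto simp: mem_r_coset_centralizer_iff r_coset_centralizer_eq_iff
          conj_by_centralizer_quandle_rep)
  qed
  thus ?thesis by (simp add: centralizer_quandle_def triplet_quandle_def)
qed

section \<open>The conjugation quandle and its connected components\<close>

lemma Conj_simps [simp]:
  "carrier (Conj G) = carrier G" "x \<triangleleft>\<^bsub>Conj G\<^esub> y = conj_by G y x"
  by (simp_all add: Conj_def conj_by_def)

lemma quandle_Conj: "quandle (Conj G)"
  unfolding quandle_def Conj_simps
proof (intro conjI ballI)
  fix y assume y: "y \<in> carrier G"
  show "bij_betw (conj_by G y) (carrier G) (carrier G)"
    by (rule bij_betw_byWitness[where f' = "conj_by G (inv y)"])
      (use y in \<open>auto simp: conj_by_conj_by\<close>)
next
  fix x y z assume "x \<in> carrier G" "y \<in> carrier G" "z \<in> carrier G"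
  thus "conj_by G z (conj_by G y x) = conj_by G (conj_by G z y) (conj_by G z x)"
    by (simp add: conj_by_def m_assoc inv_mult_group)
qed (auto simp: conj_by_def)

text \<open>Every group element is itself a point of \<open>Conj G\<close>, so a single generator of
  the inner automorphism group, the right translation by \<open>g\<close>, already carries
  \<open>b\<close> to its conjugate by \<open>g\<close>.\<close>

lemma conj_class_subset_component:
  assumes "b \<in> carrier G"
  shows "\<exists>C\<in>quandle_components (Conj G). (\<lambda>g. conj_by G g b) ` carrier G \<subseteq> C"
proof
  let ?C = "orbit (Inn (Conj G)) (\<lambda>\<phi>. \<phi>) b"
  show "?C \<in> quandle_components (Conj G)"
    using assms by (auto simp: quandle_components_def orbits_def)
  show "(\<lambda>g. conj_by G g b) ` carrier G \<subseteq> ?C"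
  proof (rule image_subsetI)
    fix g assume g: "g \<in> carrier G"
    have "right_translation (Conj G) g \<in> carrier (Inn (Conj G))"
      using g by (auto simp: Inn_def intro: generate.incl)
    moreover have "right_translation (Conj G) g b = conj_by G g b"
      using assms by (simp add: right_translation_def)
    ultimately show "conj_by G g b \<in> ?C" unfolding orbit_def by (metis (mono_tags, lifting) mem_Collect_eq)
  qed
qed

end

section \<open>Transfer of the quandle axioms along an injection\<close>

lemma quandle_distrib:
  "\<lbrakk>quandle Q; x \<in> carrier Q; y \<in> carrier Q; z \<in> carrier Q\<rbrakk> \<Longrightarrow>
    (x \<triangleleft>\<^bsub>Q\<^esub> y) \<triangleleft>\<^bsub>Q\<^esub> z = (x \<triangleleft>\<^bsub>Q\<^esub> z) \<triangleleft>\<^bsub>Q\<^esub> (y \<triangleleft>\<^bsub>Q\<^esub> z)"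
  unfolding quandle_def by blast

text \<open>An injective homomorphism reflects idempotence, self-distributivity and injectivity of
  right translations. Surjectivity of right translations can fail on a subset that is merely closed
  under the operation, whence the separate assumption \<open>surj\<close>.\<close>

lemma quandle_pullback:
  assumes R: "quandle R" and \<phi>: "\<phi> \<in> carrier Q \<rightarrow> carrier R" and inj: "inj_on \<phi> (carrier Q)"
    and ne: "carrier Q \<noteq> {}"
    and closed: "\<And>x y. x \<in> carrier Q \<Longrightarrow> y \<in> carrier Q \<Longrightarrow> x \<triangleleft>\<^bsub>Q\<^esub> y \<in> carrier Q"
    and hom: "\<And>x y. x \<in> carrier Q \<Longrightarrow> y \<in> carrier Q \<Longrightarrow> \<phi> (x \<triangleleft>\<^bsub>Q\<^esub> y) = \<phi> x \<triangleleft>\<^bsub>R\<^esub> \<phi> y"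
    and surj: "\<And>y z. y \<in> carrier Q \<Longrightarrow> z \<in> carrier Q \<Longrightarrow> \<exists>x\<in>carrier Q. x \<triangleleft>\<^bsub>Q\<^esub> y = z"
  shows "quandle Q"
  unfolding quandle_def
proof (intro conjI ballI)
  note mem = funcset_mem[OF \<phi>]
  show "carrier Q \<noteq> {}" by (rule ne)
  fix x assume x: "x \<in> carrier Q"
  show "x \<triangleleft>\<^bsub>Q\<^esub> x = x"
    using R x mem by (intro inj_onD[OF inj]) (auto simp: hom closed quandle_def)
  show "bij_betw (\<lambda>z. z \<triangleleft>\<^bsub>Q\<^esub> x) (carrier Q) (carrier Q)"
    unfolding bij_betw_def
  proof
    have "inj_on (\<lambda>a. a \<triangleleft>\<^bsub>R\<^esub> \<phi> x) (carrier R)"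
      using R mem[OF x] by (auto simp: quandle_def bij_betw_def)
    thus "inj_on (\<lambda>z. z \<triangleleft>\<^bsub>Q\<^esub> x) (carrier Q)"
      using x mem inj by (auto simp: inj_on_def) (metis hom)
    show "(\<lambda>z. z \<triangleleft>\<^bsub>Q\<^esub> x) ` carrier Q = carrier Q"
      using x surj closed by (auto simp: image_iff)
  qed
  fix y assume y: "y \<in> carrier Q"
  show "x \<triangleleft>\<^bsub>Q\<^esub> y \<in> carrier Q" using x y by (rule closed)
  fix z assume z: "z \<in> carrier Q"
  have "\<phi> ((x \<triangleleft>\<^bsub>Q\<^esub> y) \<triangleleft>\<^bsub>Q\<^esub> z) = \<phi> ((x \<triangleleft>\<^bsub>Q\<^esub> z) \<triangleleft>\<^bsub>Q\<^esub> (y \<triangleleft>\<^bsub>Q\<^esub> z))"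
    using x y z mem quandle_distrib[OF R, of "\<phi> x" "\<phi> y" "\<phi> z"] by (simp add: hom closed)
  thus "(x \<triangleleft>\<^bsub>Q\<^esub> y) \<triangleleft>\<^bsub>Q\<^esub> z = (x \<triangleleft>\<^bsub>Q\<^esub> z) \<triangleleft>\<^bsub>Q\<^esub> (y \<triangleleft>\<^bsub>Q\<^esub> z)"
    using x y z closed by (intro inj_onD[OF inj]) auto
qed

section \<open>Embedding a centralizer quandle of a subgroup into the conjugation quandle of the
  whole group\<close>

context group
begin

lemma conj_by_subgroup:
  "\<lbrakk>subgroup H G; g \<in> H\<rbrakk> \<Longrightarrow> conj_by (G\<lparr>carrier := H\<rparr>) g x = conj_by G g x"
  by (simp add: conj_by_def m_inv_consistent)

text \<open>The map is the orbit map of \<open>c\<close>, injective on cosets and compatible with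
  the operations, followed by conjugation by \<open>f\<close>, an automorphism of
  \<open>Conj G\<close>. The quandle axioms for the cosets are then pulled back from
  \<open>Conj G\<close>.\<close>

lemma centralizer_quandle_embedding:
  assumes H: "subgroup H G" and c: "c \<in> H" and f: "f \<in> carrier G"
    and \<phi>: "\<And>g. g \<in> H \<Longrightarrow>
      \<phi> (centralizer (G\<lparr>carrier := H\<rparr>) c #>\<^bsub>G\<lparr>carrier := H\<rparr>\<^esub> g) = conj_by G f (conj_by G g c)"
  shows "quandle_hom (centralizer_quandle (G\<lparr>carrier := H\<rparr>) c) (Conj G) \<phi>"
    and "inj_on \<phi> (carrier (centralizer_quandle (G\<lparr>carrier := H\<rparr>) c))"
proof -
  let ?K = "G\<lparr>carrier := H\<rparr>"
  let ?Q = "centralizer_quandle ?K c"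
  define r where "r g = centralizer ?K c #>\<^bsub>?K\<^esub> g" for g
  interpret K: group ?K by (rule subgroup_imp_group[OF H])
  have HG: "x \<in> carrier G" if "x \<in> H" for x using subgroup.mem_carrier[OF H that] .
  have K: "carrier ?K = H" by simp
  have car: "carrier ?Q = r ` H"
    using K.carrier_centralizer_quandle[of c, folded r_def, unfolded K] .
  have cj: "conj_by ?K x y = conj_by G x y" if "x \<in> H" for x y
    using H that by (rule conj_by_subgroup)
  note \<phi> = \<phi>[folded r_def]
  have r_eq: "r x = r y \<longleftrightarrow> conj_by G x c = conj_by G y c" if "x \<in> H" "y \<in> H" for x y
    using K.r_coset_centralizer_eq_iff[of c x y, folded r_def, unfolded K] c that by (simp add: cj)
  have cjH: "conj_by G x y \<in> H" if "x \<in> H" "y \<in> H" for x y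
    using K.conj_by_closed[of x y] that by (simp add: cj)
  have mult: "x \<otimes> y \<in> H" "inv x \<in> H" if "x \<in> H" "y \<in> H" for x y
    using that subgroup.m_closed[OF H] subgroup.m_inv_closed[OF H] by auto
  have op: "r x \<triangleleft>\<^bsub>?Q\<^esub> r y = r (conj_by G c (x \<otimes> inv y) \<otimes> y)"
    if "x \<in> H" "y \<in> H" for x y
    using K.centralizer_quandle_op[of c x y, folded r_def, unfolded K] that c
    by (simp add: cj m_inv_consistent[OF H])
  show inj: "inj_on \<phi> (carrier ?Q)"
    unfolding car
  proof (rule inj_onI)
    fix u v assume "u \<in> r ` H" "v \<in> r ` H" and eq: "\<phi> u = \<phi> v"
    then obtain x y where xy: "x \<in> H" "y \<in> H" "u = r x" "v = r y" by blast
    \<comment> \<open>Conjugation by \<open>f\<close> is injective and can be stripped off; equal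
      conjugates of \<open>c\<close> then mean equal cosets.\<close>
    have "conj_by G x c = conj_by G y c"
      by (rule inj_onD[OF inj_on_conj_by[OF f]]) (use xy c f eq in \<open>simp_all add: \<phi> HG\<close>)
    thus "u = v" using xy by (simp add: r_eq)
  qed
  have into: "\<phi> \<in> carrier ?Q \<rightarrow> carrier (Conj G)" using c f by (auto simp: car \<phi> HG)
  have closed: "u \<triangleleft>\<^bsub>?Q\<^esub> v \<in> carrier ?Q" if "u \<in> carrier ?Q" "v \<in> carrier ?Q" for u v
    using that c by (auto simp: car op mult cjH)
  have hom: "\<phi> (u \<triangleleft>\<^bsub>?Q\<^esub> v) = \<phi> u \<triangleleft>\<^bsub>Conj G\<^esub> \<phi> v"
    if uv: "u \<in> carrier ?Q" "v \<in> carrier ?Q" for u v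
  proof -
    obtain x y where xy: "x \<in> H" "y \<in> H" "u = r x" "v = r y" using uv car by auto
    have "\<phi> (u \<triangleleft>\<^bsub>?Q\<^esub> v) = conj_by G f (conj_by G (conj_by G y c) (conj_by G x c))"
      using xy c by (simp add: op \<phi> mult cjH conj_by_centralizer_quandle_rep HG)
    \<comment> \<open>That conjugation by \<open>f\<close> respects the operation is
      self-distributivity of \<open>Conj G\<close> with \<open>f\<close> as third argument.\<close>
    also have "\<dots> = conj_by G (conj_by G f (conj_by G y c)) (conj_by G f (conj_by G x c))"
      using quandle_distrib[OF quandle_Conj, of "conj_by G x c" "conj_by G y c" f] xy c f
      by (simp add: HG)
    finally show ?thesis using xy by (simp add: \<phi>)
  qed
  have surj: "\<exists>u\<in>carrier ?Q. u \<triangleleft>\<^bsub>?Q\<^esub> v = w"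
    if vw: "v \<in> carrier ?Q" "w \<in> carrier ?Q" for v w
  proof -
    obtain y z where yz: "y \<in> H" "z \<in> H" "v = r y" "w = r z" using vw car by auto
    \<comment> \<open>This solves \<open>conj_by G c (x \<otimes> inv y) \<otimes> y = z\<close> for
      \<open>x\<close>; the solution stays in \<open>H\<close> because \<open>c\<close>
      does.\<close>
    define x where "x = conj_by G (inv c) (z \<otimes> inv y) \<otimes> y"
    have xH: "x \<in> H" unfolding x_def using yz c by (simp add: mult cjH)
    have "conj_by G c (x \<otimes> inv y) \<otimes> y = z"
      unfolding x_def using yz c by (simp add: conj_by_conj_by m_assoc HG)
    hence "r x \<triangleleft>\<^bsub>?Q\<^esub> v = w" using yz xH by (simp add: op)
    thus ?thesis using xH car by blast
  qed
  have "carrier ?Q \<noteq> {}" using c car by blast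
  from quandle_pullback[OF quandle_Conj into inj this closed hom surj]
  show "quandle_hom ?Q (Conj G) \<phi>"
    using quandle_Conj into hom by (simp add: quandle_hom_def)
qed

end

section \<open>The canonical map on coset representatives\<close>

interpretation PSL2C: group PSL2C
  by (rule group_PSL2C)

text \<open>The formula inside \<open>F_map\<close> is the orbit map of \<open>b\<close>, hence
  constant on cosets of the centralizer of \<open>b\<close>.\<close>

lemma F_map_r_coset:
  assumes "b \<in> carrier PSL2C" "k \<in> carrier PSL2C"
  shows "F_map b (centralizer PSL2C b #>\<^bsub>PSL2C\<^esub> k) = conj_by PSL2C k b"
  unfolding F_map_def conj_by_def[symmetric]
  using assms by (intro the_elem_image_constant)
    (auto simp: PSL2C.r_coset_centralizer_self PSL2C.mem_r_coset_centralizer_iff)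

text \<open>Passing from \<open>g\<close> to \<open>f g f^-1\<close> and from
  \<open>\<gamma>\<close> to \<open>b = f \<gamma> f^-1\<close> makes the inner factors
  \<open>f\<close> cancel, leaving \<open>f g^-1 \<gamma> g f^-1\<close>. As \<open>conj_by\<close>
  puts the inverse on the left, conjugators appear as the inverse of \<open>f\<close>.\<close>

lemma canonical_map_r_coset:
  fixes \<Gamma> :: "mat2 set set"
  assumes \<Gamma>: "subgroup \<Gamma> PSL2C" and \<gamma>: "\<gamma> \<in> \<Gamma>" and f: "f \<in> carrier PSL2C"
    and b: "b = conj_by PSL2C (inv\<^bsub>PSL2C\<^esub> f) \<gamma>" and g: "g \<in> \<Gamma>"
  shows "canonical_map b f
      (centralizer (PSL2C\<lparr>carrier := \<Gamma>\<rparr>) \<gamma> #>\<^bsub>PSL2C\<lparr>carrier := \<Gamma>\<rparr>\<^esub> g)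
    = conj_by PSL2C (inv\<^bsub>PSL2C\<^esub> f) (conj_by PSL2C g \<gamma>)"
    (is "canonical_map b f ?A = _")
proof -
  let ?K = "PSL2C\<lparr>carrier := \<Gamma>\<rparr>"
  interpret K: group ?K by (rule PSL2C.subgroup_imp_group[OF \<Gamma>])
  have K: "carrier ?K = \<Gamma>" by simp
  let ?h = "\<lambda>g. f \<otimes>\<^bsub>PSL2C\<^esub> g \<otimes>\<^bsub>PSL2C\<^esub> inv\<^bsub>PSL2C\<^esub> f"
  have mem: "x \<in> carrier PSL2C" if "x \<in> \<Gamma>" for x using subgroup.mem_carrier[OF \<Gamma> that] .
  have bc: "b \<in> carrier PSL2C" using f \<gamma> b mem by simp
  have h: "conj_by PSL2C (?h x) b = conj_by PSL2C (inv\<^bsub>PSL2C\<^esub> f) (conj_by PSL2C x \<gamma>)"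
    if "x \<in> \<Gamma>" for x
    using f mem[OF \<gamma>] mem[OF that] by (simp add: b PSL2C.conj_by_conj_by PSL2C.m_assoc)
  have "psi_map b f ?A = centralizer PSL2C b #>\<^bsub>PSL2C\<^esub> ?h g"
    unfolding psi_map_def
  proof (rule the_elem_image_constant)
    show "g \<in> ?A" using K.r_coset_centralizer_self[of \<gamma> g, unfolded K] \<gamma> g by blast
    fix x assume "x \<in> ?A"
    hence "x \<in> \<Gamma> \<and> conj_by ?K x \<gamma> = conj_by ?K g \<gamma>"
      using K.mem_r_coset_centralizer_iff[of \<gamma> g x, unfolded K] \<gamma> g by blast
    \<comment> \<open>Representatives of one coset give the same conjugate of
      \<open>\<gamma>\<close>; by \<open>h\<close> their images under \<open>?h\<close> then give
      the same conjugate of \<open>b\<close>, so \<open>psi_map\<close> is well defined.\<close>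
    hence x: "x \<in> \<Gamma>" "conj_by PSL2C x \<gamma> = conj_by PSL2C g \<gamma>"
      using g PSL2C.conj_by_subgroup[OF \<Gamma>] by auto
    thus "centralizer PSL2C b #>\<^bsub>PSL2C\<^esub> ?h x = centralizer PSL2C b #>\<^bsub>PSL2C\<^esub> ?h g"
      using bc f g mem by (simp add: PSL2C.r_coset_centralizer_eq_iff h)
  qed
  thus ?thesis using bc f g mem by (simp add: canonical_map_def F_map_r_coset h)
qed

section \<open>Discrete subsets of a topological space\<close>

lemma discrete_in_iff:
  "discrete_in T S \<longleftrightarrow> S \<subseteq> topspace T \<and> (\<forall>x\<in>S. \<exists>U. openin T U \<and> U \<inter> S = {x})"
proof -
  have "subtopology T S = discrete_topology S \<longleftrightarrow> (\<forall>x\<in>S. openin (subtopology T S) {x})"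
    if "S \<subseteq> topspace T"
    using discrete_topology_unique[of S "subtopology T S"] that by (simp add: inf.absorb2) metis
  moreover have "openin (subtopology T S) {x} \<longleftrightarrow> (\<exists>U. openin T U \<and> U \<inter> S = {x})" for x
    unfolding openin_subtopology by metis
  ultimately show ?thesis unfolding discrete_in_def by metis
qed

text \<open>The preimage of an open set isolating \<open>h y\<close> in \<open>S\<close> is open,
  and injectivity of \<open>h\<close> on \<open>S'\<close> leaves \<open>y\<close> as its only point
  in \<open>S'\<close>. The identity map gives the case of subsets.\<close>

lemma discrete_in_continuous_preimage:
  assumes S: "discrete_in T S" and h: "continuous_map T' T h"
    and S': "S' \<subseteq> topspace T'" "h ` S' \<subseteq> S" and inj: "inj_on h S'"
  shows "discrete_in T' S'"
  unfolding discrete_in_iff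
proof (intro conjI ballI)
  fix y assume y: "y \<in> S'"
  then obtain U where U: "openin T U" "U \<inter> S = {h y}"
    using S S'(2) unfolding discrete_in_iff by blast
  have "openin T' {x \<in> topspace T'. h x \<in> U}" by (rule openin_continuous_map_preimage[OF h U(1)])
  moreover have "{x \<in> topspace T'. h x \<in> U} \<inter> S' = {y}"
    using U(2) y S' inj_onD[OF inj] by blast
  ultimately show "\<exists>V. openin T' V \<and> V \<inter> S' = {y}" by blast
qed (rule S'(1))

lemma discrete_in_subset: "discrete_in T S \<Longrightarrow> S' \<subseteq> S \<Longrightarrow> discrete_in T S'"
  using discrete_in_continuous_preimage[of T S T id S'] by (auto simp: discrete_in_def)

section \<open>The quotient topology on PSL(2,C) and continuity of translations\<close>

lemma topspace_PSL2C_topology: "topspace PSL2C_topology = carrier PSL2C"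
proof -
  have "\<Union>(carrier PSL2C) = carrier SL2C"
    by (auto simp: carrier_PSL2C proj_class_def SL2C_def det_uminus_mat2)
  hence "openin PSL2C_topology (carrier PSL2C)" by (simp add: openin_PSL2C_topology)
  thus ?thesis
    by (meson openin_PSL2C_topology openin_subset openin_topspace subset_antisym)
qed

text \<open>Multiplication in the quotient is the product of sets, and the four signed products of
  representatives collapse to two.\<close>

lemma mult_proj_class:
  "proj_class A \<otimes>\<^bsub>PSL2C\<^esub> proj_class B = proj_class (A ** B)"
  by (auto simp: PSL2C_def FactGroup_def set_mult_def SL2C_def proj_class_def matrix_mult_uminus)

text \<open>A matrix lies in no class other than its own, so membership in the lift of
  \<open>U\<close> to matrices can be tested on classes.\<close>

lemma mem_Union_PSL2C_iff:
  assumes "U \<subseteq> carrier PSL2C"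
  shows "A \<in> \<Union>U \<longleftrightarrow> proj_class A \<in> U"
proof
  assume "A \<in> \<Union>U"
  then obtain p where p: "p \<in> U" "A \<in> p" by blast
  then obtain B where "p = proj_class B" using assms by (auto simp: carrier_PSL2C)
  hence "p = proj_class A" using p(2) by (auto simp: proj_class_def)
  thus "proj_class A \<in> U" using p(1) by simp
qed (auto simp: proj_class_def)

text \<open>The map lifts to \<open>M \<mapsto> A ** M ** B\<close> on SL(2,C), which is continuous
  because its entries are linear in those of \<open>M\<close>.\<close>

lemma continuous_map_PSL2C_translations:
  assumes u: "u \<in> carrier PSL2C" and v: "v \<in> carrier PSL2C"
  shows "continuous_map PSL2C_topology PSL2C_topology (\<lambda>p. u \<otimes>\<^bsub>PSL2C\<^esub> p \<otimes>\<^bsub>PSL2C\<^esub> v)"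
  unfolding continuous_map
proof (intro conjI allI impI)
  show "(\<lambda>p. u \<otimes>\<^bsub>PSL2C\<^esub> p \<otimes>\<^bsub>PSL2C\<^esub> v) ` topspace PSL2C_topology \<subseteq> topspace PSL2C_topology"
    using u v by (auto simp: topspace_PSL2C_topology)
next
  fix W assume W: "openin PSL2C_topology W"
  hence WC: "W \<subseteq> carrier PSL2C" and Wo: "openin (top_of_set (carrier SL2C)) (\<Union>W)"
    by (auto simp: openin_PSL2C_topology)
  obtain A B where A: "det A = 1" "u = proj_class A" and B: "det B = 1" "v = proj_class B"
    using u v by (auto simp: carrier_PSL2C)
  let ?V = "{p \<in> topspace PSL2C_topology. u \<otimes>\<^bsub>PSL2C\<^esub> p \<otimes>\<^bsub>PSL2C\<^esub> v \<in> W}"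
  have VC: "?V \<subseteq> carrier PSL2C" by (auto simp: topspace_PSL2C_topology)
  \<comment> \<open>Openness is tested on unions of classes, so the lift of the preimage must be
    identified with the preimage of the lift.\<close>
  have "M \<in> \<Union>?V \<longleftrightarrow> M \<in> carrier SL2C \<inter> (\<lambda>M. A ** M ** B) -` \<Union>W" for M
  proof -
    have "M \<in> \<Union>?V \<longleftrightarrow> proj_class M \<in> carrier PSL2C \<and> proj_class (A ** M ** B) \<in> W"
      unfolding mem_Union_PSL2C_iff[OF VC]
      by (simp add: topspace_PSL2C_topology A B mult_proj_class)
    also have "proj_class M \<in> carrier PSL2C \<longleftrightarrow> M \<in> carrier SL2C"
      by (auto simp: carrier_PSL2C SL2C_def proj_class_def doubleton_eq_iff det_uminus_mat2)
    finally show ?thesis by (simp add: mem_Union_PSL2C_iff[OF WC] del: Union_iff)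
  qed
  hence eq: "\<Union>?V = carrier SL2C \<inter> (\<lambda>M. A ** M ** B) -` \<Union>W"
    unfolding set_eq_iff by blast
  have "continuous_on (carrier SL2C) (\<lambda>M. A ** M ** B)"
    unfolding matrix_matrix_mult_def by (intro continuous_intros)
  moreover have "(\<lambda>M. A ** M ** B) \<in> carrier SL2C \<rightarrow> carrier SL2C"
    using A B by (auto simp: SL2C_def det_mul)
  ultimately have "openin (top_of_set (carrier SL2C)) (\<Union>?V)"
    unfolding eq using Wo by (rule continuous_openin_preimage)
  thus "openin PSL2C_topology ?V" using VC by (simp add: openin_PSL2C_topology)
qed

text \<open>Discreteness is pulled back along continuous maps, so the map used is conjugation by the
  inverse of \<open>c\<close>, which carries the image back into \<open>S\<close>.\<close>

lemma discrete_in_PSL2C_conj_by: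
  assumes S: "discrete_in PSL2C_topology S" and c: "c \<in> carrier PSL2C"
  shows "discrete_in PSL2C_topology (conj_by PSL2C c ` S)"
proof (rule discrete_in_continuous_preimage[OF S])
  have SC: "S \<subseteq> carrier PSL2C" using S by (simp add: discrete_in_def topspace_PSL2C_topology)
  show "continuous_map PSL2C_topology PSL2C_topology (conj_by PSL2C (inv\<^bsub>PSL2C\<^esub> c))"
    unfolding conj_by_def using c by (intro continuous_map_PSL2C_translations) auto
  show sub: "conj_by PSL2C c ` S \<subseteq> topspace PSL2C_topology"
    using SC c by (auto simp: topspace_PSL2C_topology)
  show "conj_by PSL2C (inv\<^bsub>PSL2C\<^esub> c) ` conj_by PSL2C c ` S \<subseteq> S"
    using SC c by (auto simp: PSL2C.conj_by_conj_by subset_iff)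
  show "inj_on (conj_by PSL2C (inv\<^bsub>PSL2C\<^esub> c)) (conj_by PSL2C c ` S)"
    by (rule inj_on_subset[OF PSL2C.inj_on_conj_by])
      (use c sub in \<open>simp_all add: topspace_PSL2C_topology\<close>)
qed

section \<open>The canonical map of a Kleinian group\<close>

theorem theorem1p1:
  fixes \<Gamma> :: "mat2 set set" and \<gamma> f b :: "mat2 set" and \<tau> :: "complex set"
  assumes "Kleinian_group \<Gamma>"
    and "\<gamma> \<in> \<Gamma>" and "\<gamma> \<noteq> \<one>\<^bsub>PSL2C\<^esub>"
    and "\<tau> \<in> range trace_class" and "\<gamma> \<in> X_class \<tau>"
    and "is_base_point \<tau> b"
    and "f \<in> carrier PSL2C" and "f \<otimes>\<^bsub>PSL2C\<^esub> \<gamma> \<otimes>\<^bsub>PSL2C\<^esub> inv\<^bsub>PSL2C\<^esub> f = b"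
  shows "quandle_hom (Kleinian_quandle \<Gamma> \<gamma>) (Conj PSL2C) (canonical_map b f)
    \<and> inj_on (canonical_map b f) (carrier (Kleinian_quandle \<Gamma> \<gamma>))
    \<and> ((iso_to_finite_volume_orbifold_group \<Gamma> \<and> parabolic \<gamma>)
        \<or> (\<not> parabolic \<gamma> \<and> infinite (centralizer (PSL2C\<lparr>carrier := \<Gamma>\<rparr>) \<gamma>))
      \<longrightarrow> discrete_in PSL2C_topology (canonical_map b f ` carrier (Kleinian_quandle \<Gamma> \<gamma>))
        \<and> (\<exists>C\<in>quandle_components (Conj PSL2C). canonical_map b f ` carrier (Kleinian_quandle \<Gamma> \<gamma>) \<subseteq> C))"
proof -
  let ?K = "PSL2C\<lparr>carrier := \<Gamma>\<rparr>"
  let ?f' = "inv\<^bsub>PSL2C\<^esub> f"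
  let ?\<phi> = "canonical_map b f"
  have \<Gamma>: "subgroup \<Gamma> PSL2C" and disc: "discrete_in PSL2C_topology \<Gamma>"
    using assms(1) by (auto simp: Kleinian_group_def)
  have mem: "x \<in> carrier PSL2C" if "x \<in> \<Gamma>" for x using subgroup.mem_carrier[OF \<Gamma> that] .
  interpret K: group ?K by (rule PSL2C.subgroup_imp_group[OF \<Gamma>])
  have f': "?f' \<in> carrier PSL2C" using assms(7) by simp
  have b: "b = conj_by PSL2C ?f' \<gamma>" using assms(7,8) by (simp add: conj_by_def)
  have bc: "b \<in> carrier PSL2C" using b f' mem[OF assms(2)] by simp
  note \<phi> = canonical_map_r_coset[OF \<Gamma> assms(2,7) b]
  have Q: "Kleinian_quandle \<Gamma> \<gamma> = centralizer_quandle ?K \<gamma>" by (simp add: Kleinian_quandle_def)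
  note emb = PSL2C.centralizer_quandle_embedding[OF \<Gamma> assms(2) f' \<phi>, folded Q]
  have img: "?\<phi> ` carrier (Kleinian_quandle \<Gamma> \<gamma>)
      = (\<lambda>g. conj_by PSL2C ?f' (conj_by PSL2C g \<gamma>)) ` \<Gamma>"
    unfolding Q K.carrier_centralizer_quandle image_image
    by (rule image_cong) (simp, rule \<phi>)
  \<comment> \<open>The conjugacy class of \<open>\<gamma>\<close> in \<open>\<Gamma>\<close> is a
    subset of a discrete set, and the image is its conjugate by \<open>?f'\<close>.\<close>
  have "(\<lambda>g. conj_by PSL2C g \<gamma>) ` \<Gamma> \<subseteq> \<Gamma>"
    using K.conj_by_closed assms(2) by (auto simp: PSL2C.conj_by_subgroup[OF \<Gamma>])
  from discrete_in_PSL2C_conj_by[OF discrete_in_subset[OF disc this] f']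
  have discrete: "discrete_in PSL2C_topology (?\<phi> ` carrier (Kleinian_quandle \<Gamma> \<gamma>))"
    by (simp add: img image_image)
  have "?\<phi> ` carrier (Kleinian_quandle \<Gamma> \<gamma>) \<subseteq> (\<lambda>g. conj_by PSL2C g b) ` carrier PSL2C"
    unfolding img
  proof (rule image_subsetI)
    fix g assume "g \<in> \<Gamma>"
    hence g: "g \<in> carrier PSL2C" by (rule mem)
    \<comment> \<open>The point belonging to \<open>g\<close> is the conjugate of the base point by
      \<open>f g f^-1\<close>, so the whole image lies in the conjugacy class of
      \<open>b\<close>.\<close>
    have "conj_by PSL2C ?f' (conj_by PSL2C g \<gamma>)
        = conj_by PSL2C (f \<otimes>\<^bsub>PSL2C\<^esub> g \<otimes>\<^bsub>PSL2C\<^esub> ?f') b"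
      using g assms(7) mem[OF assms(2)] by (simp add: b PSL2C.conj_by_conj_by PSL2C.m_assoc)
    thus "conj_by PSL2C ?f' (conj_by PSL2C g \<gamma>) \<in> (\<lambda>g. conj_by PSL2C g b) ` carrier PSL2C"
      using g assms(7) by blast
  qed
  with PSL2C.conj_class_subset_component[OF bc]
  have "\<exists>C\<in>quandle_components (Conj PSL2C). ?\<phi> ` carrier (Kleinian_quandle \<Gamma> \<gamma>) \<subseteq> C"
    by (meson order_trans)
  with emb discrete show ?thesis by blast
qed

end
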